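(* Consider the consecutive sequential probability ratio test (CSPRT) for the composite hypotheses $\mathscr{H}_0,\ldots,\mathscr{H}_{m-1}$ described in the context. Assume that the likelihood function $f_n(\boldsymbol{\mathcal{X}}_n;\theta)$ is unimodal with respect to $\theta\in\Theta$ for any $n\in\mathcal{N}$. If the sampling process will eventually terminate according to the stopping rule with probability $1$, then the following statements (I)--(III) hold true: (I) $\Pr\{\text{Reject }\mathscr{H}_i\mid\theta\}\le\alpha_{i+1}+\beta_i$ for $0\le i\le m-1$ and $\theta\in\varTheta_i$. (II) For $j=1,\ldots,m-1$, the probability $\Pr\{\text{Accept }\mathscr{H}_i\text{ with some index } i \text{ no less than } j\mid\theta\}$ is no greater than $\alpha_j$ and is non-decreasing with respect to $\theta\in\Theta$ no greater than $\theta_j'$. (III) For $j=1,\ldots,m-1$, the probability $\Pr\{\text{Accept }\mathscr{H}_i\text{ with some index } i\text{ less than } j\mid\theta\}$ is no greater than $\beta_j$ and is non-increasing with respect to $\theta\in\Theta$ no less than $\theta_j''$. Moreover, the sampling process will eventually terminate according to the stopping rule with probability $1$, provided that the following additional assumption is satisfied: for arbitrary $\alpha,\beta\in(0,1)$ and $\theta\in\Theta$, $$\Pr\left\{\beta<\Upsilon_n(\boldsymbol{\mathcal{X}}_n;\theta_i',\theta_i'')<\tfrac1\alpha\;\Big|\;\theta\right\}\to0,\qquad i=1,\ldots,m-1,$$ as the sample number $n$ tends to $N^*$.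
   Context: Process. $\mathcal{N}$ is a set of positive integers (possibly finite); $N^*=\infty$ if $\mathcal{N}$ is unbounded and $N^*=\max\mathcal{N}$ otherwise (when $N^*$ is finite, a limit as $n\to N^*$ is understood as the value at $n=N^*$). $(X_n)_{n\in\mathcal{N}}$ is a discrete-time process parameterized by $\theta\in\Theta\subseteq\mathbb{R}$; $\Pr\{E\mid\theta\}$ is the probability of $E$ associated with parameter $\theta$. Write $\boldsymbol{\mathcal{X}}_n=(X_1,\ldots,X_n)$, let $f_n(\cdot;\theta)$ be its joint PDF or PMF under $\theta$; $f_n(\boldsymbol{\mathcal{X}}_n;\theta)$ is the likelihood function. Likelihood ratio notation. For $\theta',\theta''\in\Theta$, $\kappa>0$ and a relation $\sim$ among $<,=,>,\le,\ge$, "$\Upsilon_n(\boldsymbol{\mathcal{X}}_n;\theta',\theta'')\sim\kappa$" means $f_n(\boldsymbol{\mathcal{X}}_n;\theta'')\sim\kappa f_n(\boldsymbol{\mathcal{X}}_n;\theta')$ (so $\Upsilon_n$ is the likelihood ratio $f_n(\boldsymbol{\mathcal{X}}_n;\theta'')/f_n(\boldsymbol{\mathcal{X}}_n;\theta')$ when the denominator is nonzero). Unimodality. A function is unimodal with respect to $\theta\in\Theta$ if there is a number $\theta^*$ such that it is non-decreasing in $\theta\in\Theta$ no greater than $\theta^*$ and non-increasing in $\theta\in\Theta$ no less than $\theta^*$. Hypotheses. $m\ge2$, $-\infty=\theta_0<\theta_1<\cdots<\theta_{m-1}<\theta_m=\infty$, $\Theta_i=\{\theta\in\Theta:\theta_i<\theta\le\theta_{i+1}\}$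 and $\mathscr{H}_i:\theta\in\Theta_i$ for $i=0,\ldots,m-1$. Numbers $\theta_i',\theta_i''\in\Theta$ $(1\le i\le m-1)$ satisfy $\theta_i'<\theta_i<\theta_i''$ for $1\le i\le m-1$ and $\theta_i''\le\theta_{i+1}'$ for $1\le i\le m-2$; also $\theta_0''=-\infty$, $\theta_m'=\infty$. $\varTheta_i=\{\theta\in\Theta_i:\theta_i''\le\theta\le\theta_{i+1}'\}$ for $0\le i\le m-1$. Test. Fix $\alpha_i,\beta_i\in(0,1)$ for $i=1,\ldots,m-1$ and set $\alpha_m=\beta_0=0$. Continue the sampling process (over $n\in\mathcal{N}$ in increasing order) until there exists an index $j\in\{0,1,\ldots,m-1\}$ such that $\Upsilon_n(\boldsymbol{\mathcal{X}}_n;\theta_i',\theta_i'')\ge\frac1{\alpha_i}$ for $0<i\le j$ and $\Upsilon_n(\boldsymbol{\mathcal{X}}_n;\theta_i',\theta_i'')\le\beta_i$ for $j<i<m$. At the termination of the sampling process, accept $\mathscr{H}_j$ with the index $j$ satisfying the stopping condition (if several indices satisfy it, one is picked by a predetermined policy); the other hypotheses are rejected. "The sampling process will eventually terminate according to the stopping rule" means that the stopping condition is satisfied for some $n\in\mathcal{N}$; "with probability $1$" means under every $\theta\in\Theta$.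
   Formalization: For (I)–(III) the tie-breaking policy is not arbitrary: almost surely, if several indices satisfy the stopping condition, then for a pair with zero likelihood at θ_i' and θ_i'' it picks no index ≥ i (< i) when the likelihood is positive somewhere below θ_i' (above θ_i''). *)

theory Defs
  imports "HOL-Probability.Probability"
begin

definition sample :: "(nat \<Rightarrow> 'w \<Rightarrow> real) \<Rightarrow> nat \<Rightarrow> 'w \<Rightarrow> nat \<Rightarrow> real" where
  "sample X n \<omega> = (\<lambda>k\<in>{1..n}. X k \<omega>)"

definition joint_pdf ::
    "'w measure \<Rightarrow> (nat \<Rightarrow> 'w \<Rightarrow> real) \<Rightarrow> nat \<Rightarrow> ((nat \<Rightarrow> real) \<Rightarrow> real) \<Rightarrow> bool" where
  "joint_pdf M X n g \<longleftrightarrow>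
     (\<forall>x\<in>{1..n} \<rightarrow>\<^sub>E UNIV. 0 \<le> g x) \<and>
     distributed M (\<Pi>\<^sub>M k\<in>{1..n}. lborel) (sample X n) (\<lambda>x. ennreal (g x))"

definition joint_pmf ::
    "'w measure \<Rightarrow> (nat \<Rightarrow> 'w \<Rightarrow> real) \<Rightarrow> nat \<Rightarrow> ((nat \<Rightarrow> real) \<Rightarrow> real) \<Rightarrow> bool" where
  "joint_pmf M X n g \<longleftrightarrow>
     (\<exists>C. countable C \<and> (AE \<omega> in M. sample X n \<omega> \<in> C)) \<and>
     (\<forall>x\<in>{1..n} \<rightarrow>\<^sub>E UNIV. g x = measure M {\<omega>\<in>space M. sample X n \<omega> = x})"

definition unimodal_on :: "real set \<Rightarrow> (real \<Rightarrow> real) \<Rightarrow> bool" where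
  "unimodal_on \<Theta> g \<longleftrightarrow>
     (\<exists>t. mono_on {\<theta>\<in>\<Theta>. \<theta> \<le> t} g \<and> antimono_on {\<theta>\<in>\<Theta>. t \<le> \<theta>} g)"

text \<open>
  The filter for a limit along the sample sizes in \<open>N\<close> as the sample size tends to
  the supremum of \<open>N\<close>.  If \<open>N\<close> is finite, such a limit is the value at the maximum.
\<close>

definition to_sup :: "nat set \<Rightarrow> nat filter" where
  "to_sup N = (if finite N then principal {Max N} else inf sequentially (principal N))"

text \<open>
  In what follows \<open>L\<close> is the likelihood function, as a function of the parameter, for
  fixed observations.  The statement that the likelihood ratio
  \<open>\<Upsilon> = L t2 / L t1\<close> is in relation \<open>R\<close> to \<open>\<kappa>\<close> is meant in its
  cross-multiplied form, also where \<open>L t1 = 0\<close>.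
\<close>

definition LR :: "(real \<Rightarrow> real) \<Rightarrow> real \<Rightarrow> real \<Rightarrow> (real \<Rightarrow> real \<Rightarrow> bool) \<Rightarrow> real \<Rightarrow> bool" where
  "LR L t1 t2 R \<kappa> \<longleftrightarrow> R (L t2) (\<kappa> * L t1)"

definition hyp_set :: "real set \<Rightarrow> (nat \<Rightarrow> ereal) \<Rightarrow> nat \<Rightarrow> real set" where
  "hyp_set \<Theta> b i = {\<theta>\<in>\<Theta>. b i < ereal \<theta> \<and> ereal \<theta> \<le> b (Suc i)}"

text \<open>
  The interval between the upper point \<open>u i\<close> of the \<open>i\<close>-th pair and the lower point
  \<open>l (i + 1)\<close> of the next one, where \<open>u 0 = -\<infinity>\<close> and \<open>l m = \<infinity>\<close>.
\<close>

definition inner_set ::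
    "real set \<Rightarrow> nat \<Rightarrow> (nat \<Rightarrow> ereal) \<Rightarrow> (nat \<Rightarrow> real) \<Rightarrow> (nat \<Rightarrow> real) \<Rightarrow> nat \<Rightarrow> real set" where
  "inner_set \<Theta> m b l u i =
     {\<theta>\<in>hyp_set \<Theta> b i.
        (if i = 0 then - \<infinity> else ereal (u i)) \<le> ereal \<theta> \<and>
        ereal \<theta> \<le> (if Suc i = m then \<infinity> else ereal (l (Suc i)))}"

definition stop_index ::
    "nat \<Rightarrow> (nat \<Rightarrow> real) \<Rightarrow> (nat \<Rightarrow> real) \<Rightarrow> (nat \<Rightarrow> real) \<Rightarrow> (nat \<Rightarrow> real) \<Rightarrow>
     (real \<Rightarrow> real) \<Rightarrow> nat \<Rightarrow> bool" where
  "stop_index m \<alpha> \<beta> l u L j \<longleftrightarrow> j < m \<and>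
     (\<forall>i. 0 < i \<and> i \<le> j \<longrightarrow> LR L (l i) (u i) (\<ge>) (1 / \<alpha> i)) \<and>
     (\<forall>i. j < i \<and> i < m \<longrightarrow> LR L (l i) (u i) (\<le>) (\<beta> i))"

definition stop_policy ::
    "nat set \<Rightarrow> nat \<Rightarrow> (nat \<Rightarrow> real) \<Rightarrow> (nat \<Rightarrow> real) \<Rightarrow> (nat \<Rightarrow> real) \<Rightarrow> (nat \<Rightarrow> real) \<Rightarrow>
     (nat \<Rightarrow> (nat \<Rightarrow> real) \<Rightarrow> real \<Rightarrow> real) \<Rightarrow> (nat \<Rightarrow> (nat \<Rightarrow> real) \<Rightarrow> nat) \<Rightarrow> bool" where
  "stop_policy N m \<alpha> \<beta> l u f pol \<longleftrightarrow>
     (\<forall>n\<in>N. pol n \<in> (\<Pi>\<^sub>M k\<in>{1..n}. borel) \<rightarrow>\<^sub>M count_space UNIV \<and>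
       (\<forall>x\<in>{1..n} \<rightarrow>\<^sub>E UNIV. (\<exists>j. stop_index m \<alpha> \<beta> l u (f n x) j) \<longrightarrow>
          stop_index m \<alpha> \<beta> l u (f n x) (pol n x)))"

definition stops_at ::
    "nat set \<Rightarrow> nat \<Rightarrow> (nat \<Rightarrow> real) \<Rightarrow> (nat \<Rightarrow> real) \<Rightarrow> (nat \<Rightarrow> real) \<Rightarrow> (nat \<Rightarrow> real) \<Rightarrow>
     (nat \<Rightarrow> (nat \<Rightarrow> real) \<Rightarrow> real \<Rightarrow> real) \<Rightarrow> (nat \<Rightarrow> 'w \<Rightarrow> real) \<Rightarrow> nat \<Rightarrow> 'w \<Rightarrow> bool" where
  "stops_at N m \<alpha> \<beta> l u f X n \<omega> \<longleftrightarrow> n \<in> N \<and>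
     (\<exists>j. stop_index m \<alpha> \<beta> l u (f n (sample X n \<omega>)) j) \<and>
     (\<forall>k\<in>N. k < n \<longrightarrow> \<not> (\<exists>j. stop_index m \<alpha> \<beta> l u (f k (sample X k \<omega>)) j))"

definition accepts ::
    "nat set \<Rightarrow> nat \<Rightarrow> (nat \<Rightarrow> real) \<Rightarrow> (nat \<Rightarrow> real) \<Rightarrow> (nat \<Rightarrow> real) \<Rightarrow> (nat \<Rightarrow> real) \<Rightarrow>
     (nat \<Rightarrow> (nat \<Rightarrow> real) \<Rightarrow> real \<Rightarrow> real) \<Rightarrow> (nat \<Rightarrow> (nat \<Rightarrow> real) \<Rightarrow> nat) \<Rightarrow>
     (nat \<Rightarrow> 'w \<Rightarrow> real) \<Rightarrow> nat \<Rightarrow> 'w \<Rightarrow> bool" where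
  "accepts N m \<alpha> \<beta> l u f pol X j \<omega> \<longleftrightarrow>
     (\<exists>n. stops_at N m \<alpha> \<beta> l u f X n \<omega> \<and> pol n (sample X n \<omega>) = j)"

definition rejects ::
    "nat set \<Rightarrow> nat \<Rightarrow> (nat \<Rightarrow> real) \<Rightarrow> (nat \<Rightarrow> real) \<Rightarrow> (nat \<Rightarrow> real) \<Rightarrow> (nat \<Rightarrow> real) \<Rightarrow>
     (nat \<Rightarrow> (nat \<Rightarrow> real) \<Rightarrow> real \<Rightarrow> real) \<Rightarrow> (nat \<Rightarrow> (nat \<Rightarrow> real) \<Rightarrow> nat) \<Rightarrow>
     (nat \<Rightarrow> 'w \<Rightarrow> real) \<Rightarrow> nat \<Rightarrow> 'w \<Rightarrow> bool" where
  "rejects N m \<alpha> \<beta> l u f pol X i \<omega> \<longleftrightarrow>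
     (\<exists>j<m. j \<noteq> i \<and> accepts N m \<alpha> \<beta> l u f pol X j \<omega>)"

definition terminates_as ::
    "(real \<Rightarrow> 'w measure) \<Rightarrow> real set \<Rightarrow> nat set \<Rightarrow> nat \<Rightarrow> (nat \<Rightarrow> real) \<Rightarrow> (nat \<Rightarrow> real) \<Rightarrow>
     (nat \<Rightarrow> real) \<Rightarrow> (nat \<Rightarrow> real) \<Rightarrow> (nat \<Rightarrow> (nat \<Rightarrow> real) \<Rightarrow> real \<Rightarrow> real) \<Rightarrow>
     (nat \<Rightarrow> 'w \<Rightarrow> real) \<Rightarrow> bool" where
  "terminates_as P \<Theta> N m \<alpha> \<beta> l u f X \<longleftrightarrow>
     (\<forall>\<theta>\<in>\<Theta>. AE \<omega> in P \<theta>. \<exists>n\<in>N. \<exists>j. stop_index m \<alpha> \<beta> l u (f n (sample X n \<omega>)) j)"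

text \<open>
  Two different indices can satisfy the stopping condition only if the likelihood vanishes
  at both points \<open>l i\<close> and \<open>u i\<close> of some pair, so that the likelihood ratio of
  this pair is \<open>0 / 0\<close>.  If the likelihood is unimodal, it is then positive outside the
  interval from \<open>l i\<close> to \<open>u i\<close> on at most one side.  A choice \<open>k\<close> among
  several satisfying indices is consistent if it is never on the opposite side.  The condition
  is vacuous if a single index satisfies the stopping condition.

  A completely arbitrary choice makes the error bounds false: for
  \<open>N = {1}\<close>, \<open>m = 2\<close>, \<open>\<Theta> = UNIV\<close>, \<open>X 1\<close> uniform on
  \<open>{\<theta>..\<theta> + 1}\<close> and the pair \<open>0, 1 / 2\<close>, the likelihood is unimodal,
  but for \<open>\<theta> = - 10\<close> it vanishes almost surely at both points of the pair.  Both
  indices then satisfy the stopping condition, and a policy preferring the larger one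
  accepts the upper hypothesis with probability 1.
\<close>

definition consistent_choice ::
    "real set \<Rightarrow> nat \<Rightarrow> (nat \<Rightarrow> real) \<Rightarrow> (nat \<Rightarrow> real) \<Rightarrow> (nat \<Rightarrow> real) \<Rightarrow> (nat \<Rightarrow> real) \<Rightarrow>
     (real \<Rightarrow> real) \<Rightarrow> nat \<Rightarrow> bool" where
  "consistent_choice \<Theta> m \<alpha> \<beta> l u L k \<longleftrightarrow>
     ((\<exists>j1 j2. j1 \<noteq> j2 \<and> stop_index m \<alpha> \<beta> l u L j1 \<and> stop_index m \<alpha> \<beta> l u L j2) \<longrightarrow>
       (\<forall>i. 0 < i \<and> i < m \<and> L (l i) = 0 \<and> L (u i) = 0 \<longrightarrow>
          (i \<le> k \<longrightarrow> (\<forall>\<theta>\<in>\<Theta>. \<theta> < l i \<longrightarrow> L \<theta> = 0)) \<and>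
          (k < i \<longrightarrow> (\<forall>\<theta>\<in>\<Theta>. u i < \<theta> \<longrightarrow> L \<theta> = 0))))"

definition consistent_policy_as ::
    "(real \<Rightarrow> 'w measure) \<Rightarrow> real set \<Rightarrow> nat set \<Rightarrow> nat \<Rightarrow> (nat \<Rightarrow> real) \<Rightarrow> (nat \<Rightarrow> real) \<Rightarrow>
     (nat \<Rightarrow> real) \<Rightarrow> (nat \<Rightarrow> real) \<Rightarrow> (nat \<Rightarrow> (nat \<Rightarrow> real) \<Rightarrow> real \<Rightarrow> real) \<Rightarrow>
     (nat \<Rightarrow> (nat \<Rightarrow> real) \<Rightarrow> nat) \<Rightarrow> (nat \<Rightarrow> 'w \<Rightarrow> real) \<Rightarrow> bool" where
  "consistent_policy_as P \<Theta> N m \<alpha> \<beta> l u f pol X \<longleftrightarrow>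
     (\<forall>\<theta>\<in>\<Theta>. AE \<omega> in P \<theta>. \<forall>n. stops_at N m \<alpha> \<beta> l u f X n \<omega> \<longrightarrow>
        consistent_choice \<Theta> m \<alpha> \<beta> l u (f n (sample X n \<omega>)) (pol n (sample X n \<omega>)))"

end

theory Submission
  imports Defs
begin

text \<open>
  The probabilities of acceptance under two parameters are compared by a change of measure.
  To stop at time \<open>n\<close> and accept an index in \<open>J\<close> is an event about the first
  \<open>n\<close> observations.  If the likelihood \<open>L\<close> of almost every sample in this event
  satisfies \<open>L \<theta>1 \<le> c * L \<theta>2\<close>, then integrating or summing the likelihood over the
  event shows that its probability under \<open>\<theta>1\<close> is at most \<open>c\<close> times the one under
  \<open>\<theta>2\<close>.  The events for different \<open>n\<close> are disjoint, so the same bound holds for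
  the probability of accepting an index in \<open>J\<close>
  (\<open>likelihood_bound_imp_measure_bound\<close>, \<open>acceptance_probability_le\<close>).

  The pointwise inequalities come from the stopping rule.  Acceptance of an index not below
  \<open>j\<close> requires \<open>L (l j) \<le> \<alpha> j * L (u j)\<close>.  This bounds the probability under
  \<open>l j\<close> by \<open>\<alpha> j\<close>.  It also says, as \<open>\<alpha> j < 1\<close>, that the likelihood
  increases from \<open>l j\<close> to \<open>u j\<close>, unless it vanishes at both points; a unimodal
  function that increases somewhere is non-decreasing up to there.  So \<open>L \<theta>1 \<le> L \<theta>2\<close>
  for \<open>\<theta>1 \<le> \<theta>2 \<le> l j\<close>, which makes the probability monotone and carries the bound
  \<open>\<alpha> j\<close> to all smaller parameters.  If the likelihood vanishes at both points, either it
  vanishes below \<open>l j\<close>, and the inequality is trivial, or it vanishes from \<open>l j\<close>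
  on.  In the latter case \<open>j - 1\<close> satisfies the stopping condition too, and a consistent
  choice does not take an index from \<open>j\<close> on.  Acceptance of an index below \<open>j\<close> is
  symmetric.  Rejection of the \<open>i\<close>-th hypothesis means that an index above or below
  \<open>i\<close> is accepted, so the two bounds add up.

  Termination holds because unimodality prevents contradictory decisions: once the likelihood
  ratio of one pair is small, the likelihood is non-increasing from there on, and the ratios of
  all later pairs, if they are decided at all, are small or \<open>0 / 0\<close>.  So if every pair
  is decided, some index satisfies the stopping condition
  (\<open>stops_if_no_pair_undecided\<close>).  Hence the probability of never stopping is at most
  the sum over the pairs of the probabilities to be undecided at time \<open>n\<close>, for every
  \<open>n\<close>.
\<close>

section \<open>Unimodal likelihoods at a stopping index\<close>

lemma unimodal_on_nondecreasing_below:
  assumes "unimodal_on \<Theta> g" "s \<in> \<Theta>" "t \<in> \<Theta>" "s \<le> t" "g s < g t"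
    and "x \<in> \<Theta>" "y \<in> \<Theta>" "x \<le> y" "y \<le> s"
  shows "g x \<le> g y"
proof -
  obtain v where v: "mono_on {\<theta>\<in>\<Theta>. \<theta> \<le> v} g" "antimono_on {\<theta>\<in>\<Theta>. v \<le> \<theta>} g"
    using assms(1) unfolding unimodal_on_def by auto
  have "s \<le> v"
  proof (rule ccontr)
    assume "\<not> s \<le> v"
    then have "g t \<le> g s"
      using monotone_onD[OF v(2), of s t] assms by auto
    then show False using assms by simp
  qed
  then show ?thesis
    using monotone_onD[OF v(1), of x y] assms by auto
qed

lemma unimodal_on_nonincreasing_above:
  assumes "unimodal_on \<Theta> g" "s \<in> \<Theta>" "t \<in> \<Theta>" "s \<le> t" "g t < g s"
    and "x \<in> \<Theta>" "y \<in> \<Theta>" "x \<le> y" "t \<le> x"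
  shows "g y \<le> g x"
proof -
  obtain v where v: "mono_on {\<theta>\<in>\<Theta>. \<theta> \<le> v} g" "antimono_on {\<theta>\<in>\<Theta>. v \<le> \<theta>} g"
    using assms(1) unfolding unimodal_on_def by auto
  have "v \<le> t"
  proof (rule ccontr)
    assume "\<not> v \<le> t"
    then have "g s \<le> g t"
      using monotone_onD[OF v(1), of s t] assms by auto
    then show False using assms by simp
  qed
  then show ?thesis
    using monotone_onD[OF v(2), of x y] assms by auto
qed

locale test_points =
  fixes \<Theta> :: "real set" and m :: nat and l u \<alpha> \<beta> :: "nat \<Rightarrow> real"
  assumes m_pos: "0 < m"
    and points_in: "\<And>i. 0 < i \<Longrightarrow> i < m \<Longrightarrow> l i \<in> \<Theta> \<and> u i \<in> \<Theta>"
    and pair_less: "\<And>i. 0 < i \<Longrightarrow> i < m \<Longrightarrow> l i < u i"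
    and next_pair: "\<And>i. 0 < i \<Longrightarrow> Suc i < m \<Longrightarrow> u i \<le> l (Suc i)"
    and thresholds: "\<And>i. 0 < i \<Longrightarrow> i < m \<Longrightarrow> \<alpha> i \<in> {0<..<1} \<and> \<beta> i \<in> {0<..<1}"
begin

lemma pairs_ordered:
  assumes "0 < i" "i < j" "j < m"
  shows "u i \<le> l j"
proof -
  have "0 < i \<longrightarrow> j < m \<longrightarrow> u i \<le> l j"
    using \<open>i < j\<close>
  proof (induction i j rule: less_Suc_induct)
    case (1 i)
    then show ?case using next_pair by simp
  next
    case (2 i j k)
    then have "0 < i \<Longrightarrow> k < m \<Longrightarrow> l j < u j" by (intro pair_less) auto
    with 2 show ?case by force
  qed
  with assms show ?thesis by blast
qed

lemma upper_points_mono: "0 < i \<Longrightarrow> i \<le> j \<Longrightarrow> j < m \<Longrightarrow> u i \<le> u j"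
  using pairs_ordered[of i j] pair_less[of j] by (cases "i = j") auto

lemma lower_points_mono: "0 < i \<Longrightarrow> i \<le> j \<Longrightarrow> j < m \<Longrightarrow> l i \<le> l j"
  using pairs_ordered[of i j] pair_less[of i] by (cases "i = j") auto

abbreviation stops :: "(real \<Rightarrow> real) \<Rightarrow> nat \<Rightarrow> bool" where
  "stops \<equiv> stop_index m \<alpha> \<beta> l u"

end

locale unimodal_likelihood = test_points +
  fixes L :: "real \<Rightarrow> real"
  assumes unimodal: "unimodal_on \<Theta> L"
    and nonneg: "\<And>\<theta>. \<theta> \<in> \<Theta> \<Longrightarrow> 0 \<le> L \<theta>"
begin

text \<open>
  This is where the consistency of the choice enters.  If the likelihood were positive at some
  \<open>z < l j\<close>, it would have fallen to \<open>0\<close> at \<open>l j\<close> and remain \<open>0\<close>, so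
  that every pair from \<open>j\<close> on would be \<open>0 / 0\<close> and satisfy both threshold
  conditions.  Then \<open>j - 1\<close> would satisfy the stopping condition besides \<open>k\<close>.
\<close>

lemma vanishes_below_accepted_pair:
  assumes stop: "stops L k" and j: "0 < j" "j \<le> k"
    and consistent: "consistent_choice \<Theta> m \<alpha> \<beta> l u L k"
    and zero: "L (l j) = 0" "L (u j) = 0"
    and z: "z \<in> \<Theta>" "z < l j"
  shows "L z = 0"
proof (rule ccontr)
  assume "L z \<noteq> 0"
  then have pos: "0 < L z" using nonneg[OF z(1)] by simp
  have "k < m" using stop unfolding stop_index_def by simp
  with j have jm: "j < m" by simp
  have above: "L y = 0" if "y \<in> \<Theta>" "l j \<le> y" for y
    using unimodal_on_nonincreasing_above[OF unimodal z(1), of "l j" "l j" y]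
      points_in[OF j(1) jm] pos zero z nonneg[OF that(1)] that by simp
  have pair_zero: "L (l i) = 0" "L (u i) = 0" if "j \<le> i" "i < m" for i
  proof -
    have i: "0 < i" using that j by simp
    have "l j \<le> l i" using lower_points_mono[OF j(1) that] .
    then show "L (l i) = 0" "L (u i) = 0"
      using points_in[OF i that(2)] pair_less[OF i that(2)]
      by (auto intro!: above)
  qed
  have "stops L (j - 1)"
    using stop j jm pair_zero unfolding stop_index_def LR_def by auto
  moreover have "j - 1 \<noteq> k" using j by simp
  ultimately have "\<forall>i. 0 < i \<and> i < m \<and> L (l i) = 0 \<and> L (u i) = 0 \<longrightarrow>
      (i \<le> k \<longrightarrow> (\<forall>\<theta>\<in>\<Theta>. \<theta> < l i \<longrightarrow> L \<theta> = 0))"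
    using consistent stop unfolding consistent_choice_def by blast
  then have "L z = 0" using j jm zero z by blast
  with pos show False by simp
qed

text \<open>
  The mirror image: here all pairs up to \<open>j\<close> would be \<open>0 / 0\<close>, and the second index
  satisfying the stopping condition would be \<open>j\<close>.
\<close>

lemma vanishes_above_rejected_pair:
  assumes stop: "stops L k" and j: "k < j" "j < m"
    and consistent: "consistent_choice \<Theta> m \<alpha> \<beta> l u L k"
    and zero: "L (l j) = 0" "L (u j) = 0"
    and z: "z \<in> \<Theta>" "u j < z"
  shows "L z = 0"
proof (rule ccontr)
  assume "L z \<noteq> 0"
  then have pos: "0 < L z" using nonneg[OF z(1)] by simp
  have j0: "0 < j" using j by simp
  have below: "L y = 0" if "y \<in> \<Theta>" "y \<le> u j" for y
    using unimodal_on_nondecreasing_below[OF unimodal _ z(1), of "u j" y "u j"]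
      points_in[OF j0 j(2)] pos zero z nonneg[OF that(1)] that by simp
  have pair_zero: "L (l i) = 0" "L (u i) = 0" if "0 < i" "i \<le> j" for i
  proof -
    have i: "i < m" using that j by simp
    have "u i \<le> u j" using upper_points_mono[OF that j(2)] .
    then show "L (l i) = 0" "L (u i) = 0"
      using points_in[OF that(1) i] pair_less[OF that(1) i]
      by (auto intro!: below)
  qed
  have "stops L j"
    using stop j pair_zero unfolding stop_index_def LR_def by auto
  moreover have "j \<noteq> k" using j by simp
  ultimately have "\<forall>i. 0 < i \<and> i < m \<and> L (l i) = 0 \<and> L (u i) = 0 \<longrightarrow>
      (k < i \<longrightarrow> (\<forall>\<theta>\<in>\<Theta>. u i < \<theta> \<longrightarrow> L \<theta> = 0))"
    using consistent stop unfolding consistent_choice_def by blast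
  then have "L z = 0" using j j0 zero z by blast
  with pos show False by simp
qed

lemma lower_point_bound:
  assumes "stops L k" "0 < j" "j \<le> k"
  shows "L (l j) \<le> \<alpha> j * L (u j)"
proof -
  have "j < m" "1 / \<alpha> j * L (l j) \<le> L (u j)"
    using assms unfolding stop_index_def LR_def by auto
  then show ?thesis
    using thresholds[OF assms(2)] by (simp add: field_simps)
qed

lemma upper_point_bound:
  assumes "stops L k" "k < j" "j < m"
  shows "L (u j) \<le> \<beta> j * L (l j)"
  using assms unfolding stop_index_def LR_def by auto

text \<open>
  The likelihood increases strictly from \<open>l j\<close> to \<open>u j\<close> unless it vanishes at both
  points, because \<open>\<alpha> j < 1\<close>.
\<close>

lemma nondecreasing_below_accepted_pair:
  assumes stop: "stops L k" and j: "0 < j" "j \<le> k"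
    and consistent: "consistent_choice \<Theta> m \<alpha> \<beta> l u L k"
    and xy: "x \<in> \<Theta>" "y \<in> \<Theta>" "x \<le> y" "y \<le> l j"
  shows "L x \<le> L y"
proof -
  have jm: "j < m" using stop j unfolding stop_index_def by simp
  note points = points_in[OF j(1) jm] pair_less[OF j(1) jm] thresholds[OF j(1) jm]
  show ?thesis
  proof (cases "L (l j) < L (u j)")
    case True
    then show ?thesis
      using unimodal_on_nondecreasing_below[OF unimodal, of "l j" "u j" x y] points xy by simp
  next
    case False
    have bound: "L (l j) \<le> \<alpha> j * L (u j)" by (rule lower_point_bound[OF stop j])
    have "L (u j) = 0"
    proof (rule ccontr)
      assume "L (u j) \<noteq> 0"
      then have "0 < L (u j)" using nonneg points by (metis less_eq_real_def)
      then have "\<alpha> j * L (u j) < L (u j)" using points by simp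
      with bound False show False by simp
    qed
    moreover from this bound have "L (l j) = 0" using nonneg[of "l j"] points by simp
    ultimately have "L x = 0 \<or> x = l j"
      using vanishes_below_accepted_pair[OF stop j consistent _ _ xy(1)] xy by force
    then show ?thesis using nonneg[OF xy(2)] xy by auto
  qed
qed

lemma nonincreasing_above_rejected_pair:
  assumes stop: "stops L k" and j: "k < j" "j < m"
    and consistent: "consistent_choice \<Theta> m \<alpha> \<beta> l u L k"
    and xy: "x \<in> \<Theta>" "y \<in> \<Theta>" "x \<le> y" "u j \<le> x"
  shows "L y \<le> L x"
proof -
  have j0: "0 < j" using j by simp
  note points = points_in[OF j0 j(2)] pair_less[OF j0 j(2)] thresholds[OF j0 j(2)]
  show ?thesis
  proof (cases "L (u j) < L (l j)")
    case True
    then show ?thesis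
      using unimodal_on_nonincreasing_above[OF unimodal, of "l j" "u j" x y] points xy by simp
  next
    case False
    have bound: "L (u j) \<le> \<beta> j * L (l j)" by (rule upper_point_bound[OF stop j])
    have "L (l j) = 0"
    proof (rule ccontr)
      assume "L (l j) \<noteq> 0"
      then have "0 < L (l j)" using nonneg points by (metis less_eq_real_def)
      then have "\<beta> j * L (l j) < L (l j)" using points by simp
      with bound False show False by simp
    qed
    moreover from this bound have "L (u j) = 0" using nonneg[of "u j"] points by simp
    ultimately have "L y = 0 \<or> y = u j"
      using vanishes_above_rejected_pair[OF stop j consistent _ _ xy(2)] xy by force
    then show ?thesis using nonneg[OF xy(1)] xy by auto
  qed
qed

text \<open>
  The stopping index is the one just before the first pair whose ratio is below the upper
  threshold \<open>1 / \<alpha> i\<close>, or the last index if there is no such pair.  At that pair the likelihood falls strictly, so it cannot rise at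
  any later pair.
\<close>

lemma stops_if_no_pair_undecided:
  assumes decided: "\<And>i. 0 < i \<Longrightarrow> i < m \<Longrightarrow>
      \<not> (LR L (l i) (u i) (>) (\<beta> i) \<and> LR L (l i) (u i) (<) (1 / \<alpha> i))"
  shows "\<exists>j. stops L j"
proof (cases "\<exists>i. 0 < i \<and> i < m \<and> \<not> LR L (l i) (u i) (\<ge>) (1 / \<alpha> i)")
  case False
  then show ?thesis
    using m_pos unfolding stop_index_def
    by (intro exI[of _ "m - 1"]) (metis One_nat_def Suc_pred diff_less less_Suc_eq_le linorder_not_less zero_less_one)
next
  case True
  define i where "i = (LEAST i. 0 < i \<and> i < m \<and> \<not> LR L (l i) (u i) (\<ge>) (1 / \<alpha> i))"
  have i: "0 < i" "i < m" "\<not> LR L (l i) (u i) (\<ge>) (1 / \<alpha> i)"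
    using LeastI_ex[OF True] unfolding i_def by auto
  have before: "LR L (l i') (u i') (\<ge>) (1 / \<alpha> i')" if "0 < i'" "i' < i" for i'
    using not_less_Least[of i' "\<lambda>i. 0 < i \<and> i < m \<and> \<not> LR L (l i) (u i) (\<ge>) (1 / \<alpha> i)"] that i
    unfolding i_def by auto
  note points = points_in[OF i(1,2)] pair_less[OF i(1,2)] thresholds[OF i(1,2)]
  have low: "L (u i) \<le> \<beta> i * L (l i)"
    using decided[OF i(1,2)] i(3) unfolding LR_def by auto
  have "L (l i) \<noteq> 0"
    using i(3) nonneg[of "u i"] points unfolding LR_def by auto
  then have "0 < L (l i)" using nonneg[of "l i"] points by simp
  then have "\<beta> i * L (l i) < L (l i)" using points by simp
  with low have falling: "L (u i) < L (l i)" by simp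
  have after: "LR L (l k) (u k) (\<le>) (\<beta> k)" if k: "i < k" "k < m" for k
  proof -
    have k0: "0 < k" using k by simp
    note kpoints = points_in[OF k0 k(2)] pair_less[OF k0 k(2)] thresholds[OF k0 k(2)]
    have le: "L (u k) \<le> L (l k)"
      using unimodal_on_nonincreasing_above[OF unimodal, of "l i" "u i" "l k" "u k"]
        points kpoints falling pairs_ordered[OF i(1) k] by simp
    show ?thesis
    proof (cases "LR L (l k) (u k) (\<ge>) (1 / \<alpha> k)")
      case False
      then show ?thesis using decided[OF k0 k(2)] unfolding LR_def by auto
    next
      case True
      \<comment> \<open>The likelihood would have to rise here unless this pair is \<open>0 / 0\<close>.\<close>
      then have "L (l k) \<le> \<alpha> k * L (u k)"
        using kpoints unfolding LR_def by (simp add: field_simps)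
      also have "\<dots> \<le> \<alpha> k * L (l k)" using le kpoints by simp
      finally have "(1 - \<alpha> k) * L (l k) \<le> 0" by (simp add: algebra_simps)
      then have "L (l k) = 0"
        using kpoints nonneg[of "l k"] by (auto simp: mult_le_0_iff)
      then show ?thesis using le nonneg[of "u k"] kpoints unfolding LR_def by simp
    qed
  qed
  have "stops L (i - 1)"
    unfolding stop_index_def
  proof (intro conjI allI impI)
    show "i - 1 < m" using i by simp
    show "LR L (l k) (u k) (\<ge>) (1 / \<alpha> k)" if "0 < k \<and> k \<le> i - 1" for k
      using that i by (intro before) auto
    show "LR L (l k) (u k) (\<le>) (\<beta> k)" if "i - 1 < k \<and> k < m" for k
      using that after[of k] low unfolding LR_def by (cases "k = i") auto
  qed
  then show ?thesis ..
qed

end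

section \<open>Change of measure\<close>

lemma sample_in_PiE: "sample X n \<omega> \<in> {1..n} \<rightarrow>\<^sub>E UNIV"
  unfolding sample_def by auto

lemma borel_measurable_joint_pdf:
  assumes "joint_pdf Q X n g"
  shows "g \<in> borel_measurable (\<Pi>\<^sub>M k\<in>{1..n}. borel)"
proof -
  have "(\<lambda>x. ennreal (g x)) \<in> borel_measurable (\<Pi>\<^sub>M k\<in>{1..n}. lborel)"
    using assms unfolding joint_pdf_def by (auto dest: distributed_borel_measurable)
  then have "(\<lambda>x. enn2real (ennreal (g x))) \<in> borel_measurable (\<Pi>\<^sub>M k\<in>{1..n}. lborel)"
    by measurable
  moreover have "sets (\<Pi>\<^sub>M k\<in>{1..n}. lborel) = sets (\<Pi>\<^sub>M k\<in>{1..n}. (borel :: real measure))"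
    by (intro sets_PiM_cong) auto
  ultimately have "(\<lambda>x. enn2real (ennreal (g x))) \<in> borel_measurable (\<Pi>\<^sub>M k\<in>{1..n}. borel)"
    by (simp cong: measurable_cong_sets)
  then show ?thesis
    using assms unfolding joint_pdf_def
    by (subst (asm) measurable_cong[where g = g]) (auto simp: space_PiM)
qed

lemma singleton_sets_PiM_borel:
  fixes n :: nat
  assumes "x \<in> {1..n} \<rightarrow>\<^sub>E UNIV"
  shows "{x} \<in> sets (\<Pi>\<^sub>M k\<in>{1..n}. (borel :: real measure))"
proof -
  have "{x} = Pi\<^sub>E {1..n} (\<lambda>k. {x k})"
    using assms by (auto simp: PiE_singleton PiE_iff)
  moreover have "Pi\<^sub>E {1..n} (\<lambda>k. {x k}) \<in> sets (\<Pi>\<^sub>M k\<in>{1..n}. (borel :: real measure))"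
    by (rule sets_PiM_I_finite[OF finite_atLeastAtMost]) auto
  ultimately show ?thesis by simp
qed

text \<open>
  A probability mass function differs from \<open>0\<close> at countably many points only.
\<close>

lemma borel_measurable_joint_pmf:
  assumes "prob_space Q" "joint_pmf Q X n g"
    and meas: "sample X n \<in> Q \<rightarrow>\<^sub>M (\<Pi>\<^sub>M k\<in>{1..n}. borel)"
  shows "g \<in> borel_measurable (\<Pi>\<^sub>M k\<in>{1..n}. borel)"
proof -
  interpret prob_space Q by fact
  obtain C where C: "countable C" "AE \<omega> in Q. sample X n \<omega> \<in> C"
    and g: "\<And>x. x \<in> {1..n} \<rightarrow>\<^sub>E UNIV \<Longrightarrow> g x = measure Q {\<omega>\<in>space Q. sample X n \<omega> = x}"
    using assms unfolding joint_pmf_def by auto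
  show ?thesis
  proof (rule measurable_discrete_difference[where f = "\<lambda>x. 0" and X = "C \<inter> ({1..n} \<rightarrow>\<^sub>E UNIV)"])
    fix x assume x: "x \<in> space (\<Pi>\<^sub>M k\<in>{1..n}. (borel :: real measure))"
      "x \<notin> C \<inter> ({1..n} \<rightarrow>\<^sub>E UNIV)"
    then have "x \<in> {1..n} \<rightarrow>\<^sub>E UNIV" "x \<notin> C" by (auto simp: space_PiM)
    moreover from this C(2) have "AE \<omega> in Q. \<not> sample X n \<omega> = x"
      by auto
    then have "measure Q {\<omega>\<in>space Q. sample X n \<omega> = x} = 0"
      by (simp add: measure_def emeasure_eq_0_AE)
    ultimately show "0 = g x" using g by simp
  qed (use C singleton_sets_PiM_borel in auto)
qed

text \<open>
  Samples that violate the bound on the likelihoods form a null set of the first measure.  The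
  density of that measure vanishes almost everywhere on them, and a probability mass function
  vanishes at each of them, so they add nothing to the left-hand side.
\<close>

lemma likelihood_bound_imp_measure_bound:
  assumes Q: "prob_space Q1" "prob_space Q2"
    and meas: "sample X n \<in> Q1 \<rightarrow>\<^sub>M (\<Pi>\<^sub>M k\<in>{1..n}. borel)"
      "sample X n \<in> Q2 \<rightarrow>\<^sub>M (\<Pi>\<^sub>M k\<in>{1..n}. borel)"
    and joint: "joint_pdf Q1 X n g1 \<and> joint_pdf Q2 X n g2 \<or>
      joint_pmf Q1 X n g1 \<and> joint_pmf Q2 X n g2"
    and B: "B \<in> sets (\<Pi>\<^sub>M k\<in>{1..n}. borel)"
    and c: "0 \<le> c"
    and bound: "AE \<omega> in Q1. sample X n \<omega> \<in> B \<longrightarrow> g1 (sample X n \<omega>) \<le> c * g2 (sample X n \<omega>)"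
  shows "emeasure Q1 (sample X n -` B \<inter> space Q1)
      \<le> ennreal c * emeasure Q2 (sample X n -` B \<inter> space Q2)"
proof -
  interpret Q1: prob_space Q1 by fact
  interpret Q2: prob_space Q2 by fact
  show ?thesis
    using joint
  proof
    assume "joint_pdf Q1 X n g1 \<and> joint_pdf Q2 X n g2"
    then have pdf: "joint_pdf Q1 X n g1" "joint_pdf Q2 X n g2" by auto
    let ?R = "\<Pi>\<^sub>M k\<in>{1..n}. (lborel :: real measure)"
    have sets_R: "sets ?R = sets (\<Pi>\<^sub>M k\<in>{1..n}. borel)" by (intro sets_PiM_cong) auto
    have g_meas [measurable]: "g1 \<in> borel_measurable ?R" "g2 \<in> borel_measurable ?R"
      unfolding measurable_cong_sets[OF sets_R refl]
      by (fact borel_measurable_joint_pdf[OF pdf(1)] borel_measurable_joint_pdf[OF pdf(2)])+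
    have BR [measurable]: "B \<in> sets ?R" using B sets_R by simp
    have D: "distributed Q1 ?R (sample X n) (\<lambda>x. ennreal (g1 x))"
      "distributed Q2 ?R (sample X n) (\<lambda>x. ennreal (g2 x))"
      using pdf unfolding joint_pdf_def by auto
    have nonneg: "0 \<le> g2 x" if "x \<in> space ?R" for x
      using pdf that unfolding joint_pdf_def by (auto simp: space_PiM)
    have "AE x in distr Q1 ?R (sample X n). x \<in> B \<longrightarrow> g1 x \<le> c * g2 x"
    proof (subst AE_distr_iff)
      show "sample X n \<in> Q1 \<rightarrow>\<^sub>M ?R" by (rule distributed_measurable[OF D(1)])
      show "{x \<in> space ?R. x \<in> B \<longrightarrow> g1 x \<le> c * g2 x} \<in> sets ?R"
      proof (rule predE, rule pred_intros_logic(4))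
        show "Measurable.pred ?R (\<lambda>x. x \<in> B)" by measurable
        show "Measurable.pred ?R (\<lambda>x. g1 x \<le> c * g2 x)"
          unfolding pred_def
          by (intro borel_measurable_le borel_measurable_times borel_measurable_const g_meas)
      qed
    qed (rule bound)
    then have "AE x in ?R. 0 < ennreal (g1 x) \<longrightarrow> x \<in> B \<longrightarrow> g1 x \<le> c * g2 x"
      unfolding distributed_distr_eq_density[OF D(1)] AE_density[OF distributed_borel_measurable[OF D(1)]] .
    then have "AE x in ?R. ennreal (g1 x) * indicator B x \<le> ennreal c * (ennreal (g2 x) * indicator B x)"
      using AE_space
    proof eventually_elim
      case (elim x)
      show ?case
      proof (cases "x \<in> B \<and> 0 < g1 x")
        case True
        then have "ennreal (g1 x) \<le> ennreal (c * g2 x)"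
          using elim(1) by (intro ennreal_leI) auto
        with True show ?thesis using c nonneg[OF elim(2)] by (simp add: ennreal_mult)
      next
        case False
        then show ?thesis by (auto simp: ennreal_neg)
      qed
    qed
    then have "(\<integral>\<^sup>+x. ennreal (g1 x) * indicator B x \<partial>?R)
        \<le> (\<integral>\<^sup>+x. ennreal c * (ennreal (g2 x) * indicator B x) \<partial>?R)"
      by (rule nn_integral_mono_AE)
    also have "\<dots> = ennreal c * (\<integral>\<^sup>+x. ennreal (g2 x) * indicator B x \<partial>?R)"
      by (rule nn_integral_cmult) measurable
    finally show ?thesis
      by (simp add: distributed_emeasure[OF D(1) BR] distributed_emeasure[OF D(2) BR])
  next
    assume "joint_pmf Q1 X n g1 \<and> joint_pmf Q2 X n g2"
    then obtain C1 C2 where C: "countable C1" "AE \<omega> in Q1. sample X n \<omega> \<in> C1"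
        "countable C2" "AE \<omega> in Q2. sample X n \<omega> \<in> C2"
      and g1: "\<And>x. x \<in> {1..n} \<rightarrow>\<^sub>E UNIV \<Longrightarrow> g1 x = measure Q1 {\<omega>\<in>space Q1. sample X n \<omega> = x}"
      and g2: "\<And>x. x \<in> {1..n} \<rightarrow>\<^sub>E UNIV \<Longrightarrow> g2 x = measure Q2 {\<omega>\<in>space Q2. sample X n \<omega> = x}"
      unfolding joint_pmf_def by auto
    let ?R = "\<Pi>\<^sub>M k\<in>{1..n}. (borel :: real measure)"
    \<comment> \<open>Up to a null set, \<open>B\<close> is a countable set of points on which the mass functions
      can be compared one by one.\<close>
    define S where "S = B \<inter> (C1 \<union> C2)"
    have B_sub: "B \<subseteq> {1..n} \<rightarrow>\<^sub>E UNIV" using sets.sets_into_space[OF B] by (simp add: space_PiM)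
    have S: "countable S" "S \<subseteq> {1..n} \<rightarrow>\<^sub>E UNIV" "S \<subseteq> B"
      using C B_sub unfolding S_def by auto
    have S_point: "{x} \<in> sets ?R" if "x \<in> S" for x
      using S(2) that by (intro singleton_sets_PiM_borel) blast
    have S_sets: "S \<in> sets ?R"
      by (rule sets.countable[OF S_point S(1)])
    have point1: "emeasure (distr Q1 ?R (sample X n)) {x} = ennreal (g1 x)"
      and point2: "emeasure (distr Q2 ?R (sample X n)) {x} = ennreal (g2 x)"
      if "x \<in> S" for x
    proof -
      have x: "x \<in> {1..n} \<rightarrow>\<^sub>E UNIV" using that S by auto
      have *: "sample X n -` {x} \<inter> A = {\<omega>\<in>A. sample X n \<omega> = x}" for A by auto
      show "emeasure (distr Q1 ?R (sample X n)) {x} = ennreal (g1 x)"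
        unfolding emeasure_distr[OF meas(1) singleton_sets_PiM_borel[OF x]] * g1[OF x]
        by (rule Q1.emeasure_eq_measure)
      show "emeasure (distr Q2 ?R (sample X n)) {x} = ennreal (g2 x)"
        unfolding emeasure_distr[OF meas(2) singleton_sets_PiM_borel[OF x]] * g2[OF x]
        by (rule Q2.emeasure_eq_measure)
    qed
    have le: "g1 x \<le> c * g2 x" if "x \<in> S" for x
    proof (rule ccontr)
      assume not_le: "\<not> g1 x \<le> c * g2 x"
      have x: "x \<in> {1..n} \<rightarrow>\<^sub>E UNIV" "x \<in> B" using that S by auto
      have "AE \<omega> in Q1. \<not> sample X n \<omega> = x"
        using bound by eventually_elim (use not_le x in auto)
      then have "g1 x = 0" by (simp add: g1[OF x(1)] measure_def emeasure_eq_0_AE)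
      moreover have "0 \<le> c * g2 x" using c g2[OF x(1)] by simp
      ultimately show False using not_le by simp
    qed
    have "emeasure Q1 (sample X n -` B \<inter> space Q1) = emeasure Q1 (sample X n -` S \<inter> space Q1)"
    proof (rule emeasure_eq_AE)
      show "AE \<omega> in Q1. \<omega> \<in> sample X n -` B \<inter> space Q1 \<longleftrightarrow> \<omega> \<in> sample X n -` S \<inter> space Q1"
        using C(2) by eventually_elim (auto simp: S_def)
    qed (intro measurable_sets[OF meas(1)] B S_sets)+
    also have "\<dots> = emeasure (distr Q1 ?R (sample X n)) S"
      by (rule emeasure_distr[OF meas(1) S_sets, symmetric])
    also have "\<dots> = (\<integral>\<^sup>+x. emeasure (distr Q1 ?R (sample X n)) {x} \<partial>count_space S)"
      by (rule emeasure_countable_singleton) (unfold sets_distr, erule S_point, rule S(1))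
    also have "\<dots> \<le> (\<integral>\<^sup>+x. ennreal c * emeasure (distr Q2 ?R (sample X n)) {x} \<partial>count_space S)"
    proof (rule nn_integral_mono)
      fix x assume "x \<in> space (count_space S)"
      then have x: "x \<in> S" by simp
      have "ennreal (g1 x) \<le> ennreal (c * g2 x)" by (rule ennreal_leI[OF le[OF x]])
      then show "emeasure (distr Q1 ?R (sample X n)) {x} \<le> ennreal c * emeasure (distr Q2 ?R (sample X n)) {x}"
        unfolding point1[OF x] point2[OF x] ennreal_mult'[OF c] .
    qed
    also have "\<dots> = ennreal c * (\<integral>\<^sup>+x. emeasure (distr Q2 ?R (sample X n)) {x} \<partial>count_space S)"
      by (rule nn_integral_cmult) simp
    also have "\<dots> = ennreal c * emeasure (distr Q2 ?R (sample X n)) S"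
      by (subst emeasure_countable_singleton) (unfold sets_distr, erule S_point, rule S(1), rule refl)
    also have "\<dots> \<le> ennreal c * emeasure Q2 (sample X n -` B \<inter> space Q2)"
      unfolding emeasure_distr[OF meas(2) S_sets]
    proof (intro mult_left_mono emeasure_mono)
      show "sample X n -` S \<inter> space Q2 \<subseteq> sample X n -` B \<inter> space Q2"
        using S(3) by auto
    qed (rule measurable_sets[OF meas(2) B], simp)
    finally show ?thesis .
  qed
qed

section \<open>The law of the stopped test\<close>

lemma to_sup_nontrivial:
  assumes "N \<noteq> {}"
  shows "to_sup N \<noteq> bot \<and> eventually (\<lambda>n. n \<in> N) (to_sup N)"
proof (cases "finite N")
  case True
  then show ?thesis using assms unfolding to_sup_def
    by (simp add: principal_eq_bot_iff eventually_principal)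
next
  case False
  have "\<not> (\<forall>\<^sub>F n in sequentially. n \<notin> N)"
    using False unfolding eventually_sequentially infinite_nat_iff_unbounded_le by blast
  then show ?thesis using False unfolding to_sup_def
    by (simp add: trivial_limit_def eventually_inf_principal)
qed

locale csprt = test_points \<Theta> m l u \<alpha> \<beta>
  for \<Theta> :: "real set" and m :: nat and l u \<alpha> \<beta> :: "nat \<Rightarrow> real" +
  fixes M :: "'w measure" and P :: "real \<Rightarrow> 'w measure"
    and N :: "nat set" and X :: "nat \<Rightarrow> 'w \<Rightarrow> real"
    and f :: "nat \<Rightarrow> (nat \<Rightarrow> real) \<Rightarrow> real \<Rightarrow> real"
    and pol :: "nat \<Rightarrow> (nat \<Rightarrow> real) \<Rightarrow> nat"
  assumes prob: "\<And>\<theta>. \<theta> \<in> \<Theta> \<Longrightarrow> prob_space (P \<theta>)"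
    and sets_P: "\<And>\<theta>. \<theta> \<in> \<Theta> \<Longrightarrow> sets (P \<theta>) = sets M"
    and X_measurable: "\<And>n k. n \<in> N \<Longrightarrow> k \<in> {1..n} \<Longrightarrow> X k \<in> borel_measurable M"
    and likelihood:
      "(\<forall>n\<in>N. \<forall>\<theta>\<in>\<Theta>. joint_pdf (P \<theta>) X n (\<lambda>x. f n x \<theta>)) \<or>
       (\<forall>n\<in>N. \<forall>\<theta>\<in>\<Theta>. joint_pmf (P \<theta>) X n (\<lambda>x. f n x \<theta>))"
    and policy: "stop_policy N m \<alpha> \<beta> l u f pol"
    and unimodal: "\<And>n \<omega>. n \<in> N \<Longrightarrow> \<omega> \<in> space M \<Longrightarrow> unimodal_on \<Theta> (f n (sample X n \<omega>))"
begin

lemma space_P: "\<theta> \<in> \<Theta> \<Longrightarrow> space (P \<theta>) = space M"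
  using sets_P by (rule sets_eq_imp_space_eq)

lemma sample_measurable:
  "n \<in> N \<Longrightarrow> sample X n \<in> M \<rightarrow>\<^sub>M (\<Pi>\<^sub>M k\<in>{1..n}. borel)"
  unfolding sample_def[abs_def] by (intro measurable_restrict X_measurable)

lemma sample_measurable_P:
  "\<theta> \<in> \<Theta> \<Longrightarrow> n \<in> N \<Longrightarrow> sample X n \<in> P \<theta> \<rightarrow>\<^sub>M (\<Pi>\<^sub>M k\<in>{1..n}. borel)"
  using sample_measurable measurable_cong_sets[OF sets_P refl] by blast

lemma likelihood_measurable:
  "n \<in> N \<Longrightarrow> \<theta> \<in> \<Theta> \<Longrightarrow> (\<lambda>x. f n x \<theta>) \<in> borel_measurable (\<Pi>\<^sub>M k\<in>{1..n}. borel)"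
  using likelihood borel_measurable_joint_pdf
    borel_measurable_joint_pmf[OF prob _ sample_measurable_P] by blast

lemma unimodal_likelihood_sample:
  assumes n: "n \<in> N" and \<omega>: "\<omega> \<in> space M"
  shows "unimodal_likelihood \<Theta> m l u \<alpha> \<beta> (f n (sample X n \<omega>))"
proof unfold_locales
  show "unimodal_on \<Theta> (f n (sample X n \<omega>))" using unimodal n \<omega> .
  show "0 \<le> f n (sample X n \<omega>) \<theta>" if "\<theta> \<in> \<Theta>" for \<theta>
    using likelihood n that sample_in_PiE[of X n \<omega>]
    unfolding joint_pdf_def joint_pmf_def by fastforce
qed

lemma stop_index_measurable:
  assumes n: "n \<in> N"
  shows "Measurable.pred (\<Pi>\<^sub>M k\<in>{1..n}. borel) (\<lambda>x. \<exists>j. stops (f n x) j)"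
proof -
  have lr: "Measurable.pred (\<Pi>\<^sub>M k\<in>{1..n}. borel) (\<lambda>x. LR (f n x) (l i) (u i) (\<ge>) c)"
      "Measurable.pred (\<Pi>\<^sub>M k\<in>{1..n}. borel) (\<lambda>x. LR (f n x) (l i) (u i) (\<le>) c)"
    if i: "0 < i" "i < m" for i c
  proof -
    have meas: "(\<lambda>x. f n x (l i)) \<in> borel_measurable (\<Pi>\<^sub>M k\<in>{1..n}. borel)"
        "(\<lambda>x. f n x (u i)) \<in> borel_measurable (\<Pi>\<^sub>M k\<in>{1..n}. borel)"
      using likelihood_measurable[OF n] points_in[OF i] by blast+
    show "Measurable.pred (\<Pi>\<^sub>M k\<in>{1..n}. borel) (\<lambda>x. LR (f n x) (l i) (u i) (\<ge>) c)"
        "Measurable.pred (\<Pi>\<^sub>M k\<in>{1..n}. borel) (\<lambda>x. LR (f n x) (l i) (u i) (\<le>) c)"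
      unfolding LR_def pred_def
      by (intro borel_measurable_le borel_measurable_times borel_measurable_const meas)+
  qed
  have "Measurable.pred (\<Pi>\<^sub>M k\<in>{1..n}. borel) (\<lambda>x. stops (f n x) j)" if "j < m" for j
    unfolding stop_index_def
    by (intro pred_intros_logic pred_intros_countable pred_intros_imp' lr) (use that in auto)
  then have "Measurable.pred (\<Pi>\<^sub>M k\<in>{1..n}. borel) (\<lambda>x. j < m \<and> stops (f n x) j)" for j
    by (intro pred_intros_conj1')
  then have "Measurable.pred (\<Pi>\<^sub>M k\<in>{1..n}. borel) (\<lambda>x. \<exists>j. j < m \<and> stops (f n x) j)"
    by (intro pred_intros_countable)
  moreover have "j < m \<and> stops L j \<longleftrightarrow> stops L j" for j L
    unfolding stop_index_def by auto
  ultimately show ?thesis by simp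
qed

text \<open>
  The samples of size \<open>n\<close> at which the test stops and accepts an index in \<open>J\<close>.  The
  earlier samples are restrictions of the present one, which makes the event a subset of the
  sample space at time \<open>n\<close>, where the joint density or mass function applies.
\<close>

definition stop_region :: "nat \<Rightarrow> nat set \<Rightarrow> (nat \<Rightarrow> real) set" where
  "stop_region n J = {x \<in> space (\<Pi>\<^sub>M k\<in>{1..n}. borel).
     (\<exists>j. stops (f n x) j) \<and>
     (\<forall>k\<in>N. k < n \<longrightarrow> \<not> (\<exists>j. stops (f k (restrict x {1..k})) j)) \<and> pol n x \<in> J}"

lemma stop_region_measurable:
  assumes n: "n \<in> N"
  shows "stop_region n J \<in> sets (\<Pi>\<^sub>M k\<in>{1..n}. borel)"
proof -
  let ?R = "\<lambda>n. \<Pi>\<^sub>M k\<in>{1..n}. (borel :: real measure)"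
  have earlier: "Measurable.pred (?R n) (\<lambda>x. \<exists>j. stops (f k (restrict x {1..k})) j)" if "k \<in> N" "k < n" for k
    by (rule measurable_compose[OF measurable_restrict_subset stop_index_measurable[OF that(1)]])
      (use that in auto)
  have choice: "Measurable.pred (?R n) (\<lambda>x. pol n x \<in> J)"
    using policy n unfolding stop_policy_def by (auto intro!: pred_sets2[of _ "count_space UNIV"])
  have "Measurable.pred (?R n) (\<lambda>x. (\<exists>j. stops (f n x) j) \<and>
     (\<forall>k. k \<in> N \<longrightarrow> k < n \<longrightarrow> \<not> (\<exists>j. stops (f k (restrict x {1..k})) j)) \<and> pol n x \<in> J)"
    by (intro pred_intros_logic(2,3) pred_intros_countable(1) pred_intros_imp'
        stop_index_measurable[OF n] earlier choice)
  then show ?thesis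
    unfolding stop_region_def Ball_def by (rule predE)
qed

definition stopped_in :: "nat \<Rightarrow> nat set \<Rightarrow> 'w set" where
  "stopped_in n J = {\<omega> \<in> space M. stops_at N m \<alpha> \<beta> l u f X n \<omega> \<and> pol n (sample X n \<omega>) \<in> J}"

lemma stopped_in_eq_vimage:
  assumes "n \<in> N"
  shows "stopped_in n J = sample X n -` stop_region n J \<inter> space M"
proof -
  have "restrict (sample X n \<omega>) {1..k} = sample X k \<omega>" if "k < n" for k \<omega>
    using that unfolding sample_def by (auto simp: fun_eq_iff)
  then show ?thesis
    using assms sample_in_PiE[of X n] unfolding stopped_in_def stop_region_def stops_at_def
    by (auto simp: space_PiM)
qed

lemma stopped_in_sets: "stopped_in n J \<in> sets M"
proof (cases "n \<in> N")
  case True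
  then show ?thesis
    using measurable_sets[OF sample_measurable stop_region_measurable]
    by (simp add: stopped_in_eq_vimage)
next
  case False
  then show ?thesis by (simp add: stopped_in_def stops_at_def)
qed

lemma disjoint_stopped_in: "disjoint_family (\<lambda>n. stopped_in n J)"
proof -
  have "n = k" if "stops_at N m \<alpha> \<beta> l u f X n \<omega>" "stops_at N m \<alpha> \<beta> l u f X k \<omega>" for n k \<omega>
    using that unfolding stops_at_def by (meson linorder_neqE_nat)
  then show ?thesis
    unfolding disjoint_family_on_def stopped_in_def by blast
qed

abbreviation accepts_in :: "nat set \<Rightarrow> 'w \<Rightarrow> bool" where
  "accepts_in J \<omega> \<equiv> \<exists>i\<in>J. accepts N m \<alpha> \<beta> l u f pol X i \<omega>"

lemma accepts_in_eq_UN_stopped_in: "{\<omega> \<in> space M. accepts_in J \<omega>} = (\<Union>n. stopped_in n J)"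
  unfolding accepts_def stopped_in_def by auto

lemma accepts_in_sets: "{\<omega> \<in> space M. accepts_in J \<omega>} \<in> sets M"
  unfolding accepts_in_eq_UN_stopped_in using stopped_in_sets by auto

text \<open>
  The pointwise bound is asked only of likelihoods that the test can meet when it stops with an
  index in \<open>J\<close>.  The events of stopping at time \<open>n\<close> are compared one at a time and
  then added up over \<open>n\<close>.
\<close>

lemma acceptance_probability_le:
  assumes \<theta>: "\<theta>1 \<in> \<Theta>" "\<theta>2 \<in> \<Theta>" and c: "0 \<le> c"
    and consistent: "consistent_policy_as P \<Theta> N m \<alpha> \<beta> l u f pol X"
    and bound: "\<And>L k. unimodal_likelihood \<Theta> m l u \<alpha> \<beta> L \<Longrightarrow> stops L k \<Longrightarrow> k \<in> J \<Longrightarrow>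
        consistent_choice \<Theta> m \<alpha> \<beta> l u L k \<Longrightarrow> L \<theta>1 \<le> c * L \<theta>2"
  shows "measure (P \<theta>1) {\<omega>\<in>space (P \<theta>1). accepts_in J \<omega>}
      \<le> c * measure (P \<theta>2) {\<omega>\<in>space (P \<theta>2). accepts_in J \<omega>}"
proof -
  interpret P1: prob_space "P \<theta>1" using prob \<theta> by simp
  interpret P2: prob_space "P \<theta>2" using prob \<theta> by simp
  have stopped: "emeasure (P \<theta>1) (stopped_in n J) \<le> ennreal c * emeasure (P \<theta>2) (stopped_in n J)" for n
  proof (cases "n \<in> N")
    case False
    then have "stopped_in n J = {}" unfolding stopped_in_def stops_at_def by auto
    then show ?thesis by simp
  next
    case n: True
    have "AE \<omega> in P \<theta>1. \<forall>n. stops_at N m \<alpha> \<beta> l u f X n \<omega> \<longrightarrow>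
        consistent_choice \<Theta> m \<alpha> \<beta> l u (f n (sample X n \<omega>)) (pol n (sample X n \<omega>))"
      using consistent \<theta> unfolding consistent_policy_as_def by blast
    then have "AE \<omega> in P \<theta>1. sample X n \<omega> \<in> stop_region n J \<longrightarrow>
        f n (sample X n \<omega>) \<theta>1 \<le> c * f n (sample X n \<omega>) \<theta>2"
      using AE_space
    proof eventually_elim
      case (elim \<omega>)
      show ?case
      proof
        assume "sample X n \<omega> \<in> stop_region n J"
        moreover have \<omega>: "\<omega> \<in> space M" using elim(2) space_P \<theta> by simp
        ultimately have "\<omega> \<in> stopped_in n J" using stopped_in_eq_vimage[OF n] by auto
        then have st: "stops_at N m \<alpha> \<beta> l u f X n \<omega>" "pol n (sample X n \<omega>) \<in> J"
          unfolding stopped_in_def by auto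
        moreover have "stops (f n (sample X n \<omega>)) (pol n (sample X n \<omega>))"
          using st n policy sample_in_PiE[of X n \<omega>] unfolding stop_policy_def stops_at_def by blast
        ultimately show "f n (sample X n \<omega>) \<theta>1 \<le> c * f n (sample X n \<omega>) \<theta>2"
          using bound[OF unimodal_likelihood_sample[OF n \<omega>]] elim(1) by blast
      qed
    qed
    moreover have "joint_pdf (P \<theta>1) X n (\<lambda>x. f n x \<theta>1) \<and> joint_pdf (P \<theta>2) X n (\<lambda>x. f n x \<theta>2) \<or>
        joint_pmf (P \<theta>1) X n (\<lambda>x. f n x \<theta>1) \<and> joint_pmf (P \<theta>2) X n (\<lambda>x. f n x \<theta>2)"
      using likelihood n \<theta> by blast
    ultimately show ?thesis
      using likelihood_bound_imp_measure_bound[OF prob[OF \<theta>(1)] prob[OF \<theta>(2)]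
          sample_measurable_P[OF \<theta>(1) n] sample_measurable_P[OF \<theta>(2) n] _ stop_region_measurable[OF n] c]
      by (simp add: stopped_in_eq_vimage[OF n] space_P \<theta>)
  qed
  have eq: "emeasure (P \<theta>) {\<omega>\<in>space (P \<theta>). accepts_in J \<omega>} = (\<Sum>n. emeasure (P \<theta>) (stopped_in n J))"
    if "\<theta> \<in> \<Theta>" for \<theta>
    unfolding space_P[OF that] accepts_in_eq_UN_stopped_in
    using stopped_in_sets sets_P[OF that] disjoint_stopped_in by (intro suminf_emeasure[symmetric]) auto
  have "emeasure (P \<theta>1) {\<omega>\<in>space (P \<theta>1). accepts_in J \<omega>}
      \<le> ennreal c * emeasure (P \<theta>2) {\<omega>\<in>space (P \<theta>2). accepts_in J \<omega>}"
    unfolding eq[OF \<theta>(1)] eq[OF \<theta>(2)] ennreal_suminf_cmult[symmetric]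
    using stopped by (intro suminf_le) auto
  then show ?thesis
    using c by (simp add: P1.emeasure_eq_measure P2.emeasure_eq_measure ennreal_mult'[symmetric])
qed

context
  assumes consistent: "consistent_policy_as P \<Theta> N m \<alpha> \<beta> l u f pol X"
begin

lemma upper_acceptance_mono:
  assumes j: "0 < j" "j < m"
  shows "mono_on {\<theta>\<in>\<Theta>. \<theta> \<le> l j}
    (\<lambda>\<theta>. measure (P \<theta>) {\<omega>\<in>space (P \<theta>). accepts_in {j..<m} \<omega>})"
proof (rule monotone_onI)
  fix x y assume xy: "x \<in> {\<theta>\<in>\<Theta>. \<theta> \<le> l j}" "y \<in> {\<theta>\<in>\<Theta>. \<theta> \<le> l j}" "x \<le> y"
  have "measure (P x) {\<omega>\<in>space (P x). accepts_in {j..<m} \<omega>}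
      \<le> 1 * measure (P y) {\<omega>\<in>space (P y). accepts_in {j..<m} \<omega>}"
  proof (rule acceptance_probability_le[OF _ _ _ consistent])
    fix L k assume "unimodal_likelihood \<Theta> m l u \<alpha> \<beta> L" "stops L k" "k \<in> {j..<m}"
      "consistent_choice \<Theta> m \<alpha> \<beta> l u L k"
    then show "L x \<le> 1 * L y"
      using unimodal_likelihood.nondecreasing_below_accepted_pair[of \<Theta> m l u \<alpha> \<beta> L k j x y] xy j
      by simp
  qed (use xy in simp_all)
  then show "measure (P x) {\<omega>\<in>space (P x). accepts_in {j..<m} \<omega>}
      \<le> measure (P y) {\<omega>\<in>space (P y). accepts_in {j..<m} \<omega>}" by simp
qed

text \<open>
  By monotonicity the parameter \<open>l j\<close> is the worst case, and there the threshold
  \<open>1 / \<alpha> j\<close> compares with the probability under \<open>u j\<close>, which is at most \<open>1\<close>.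
\<close>

lemma upper_acceptance_le:
  assumes j: "0 < j" "j < m" and \<theta>: "\<theta> \<in> \<Theta>" "\<theta> \<le> l j"
  shows "measure (P \<theta>) {\<omega>\<in>space (P \<theta>). accepts_in {j..<m} \<omega>} \<le> \<alpha> j"
proof -
  note points = points_in[OF j] thresholds[OF j]
  interpret Pu: prob_space "P (u j)" using prob points by simp
  have "measure (P \<theta>) {\<omega>\<in>space (P \<theta>). accepts_in {j..<m} \<omega>}
      \<le> measure (P (l j)) {\<omega>\<in>space (P (l j)). accepts_in {j..<m} \<omega>}"
    by (rule monotone_onD[OF upper_acceptance_mono[OF j]]) (use \<theta> points in simp_all)
  also have "\<dots> \<le> \<alpha> j * measure (P (u j)) {\<omega>\<in>space (P (u j)). accepts_in {j..<m} \<omega>}"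
  proof (rule acceptance_probability_le[OF _ _ _ consistent])
    fix L k assume "unimodal_likelihood \<Theta> m l u \<alpha> \<beta> L" "stops L k" "k \<in> {j..<m}"
      "consistent_choice \<Theta> m \<alpha> \<beta> l u L k"
    then show "L (l j) \<le> \<alpha> j * L (u j)"
      using unimodal_likelihood.lower_point_bound[of \<Theta> m l u \<alpha> \<beta> L k j] j
      by simp
  qed (use points in simp_all)
  also have "\<dots> \<le> \<alpha> j * 1"
    using points by (intro mult_left_mono) auto
  finally show ?thesis by simp
qed

lemma lower_acceptance_antimono:
  assumes j: "0 < j" "j < m"
  shows "antimono_on {\<theta>\<in>\<Theta>. u j \<le> \<theta>}
    (\<lambda>\<theta>. measure (P \<theta>) {\<omega>\<in>space (P \<theta>). accepts_in {..<j} \<omega>})"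
proof (rule monotone_onI)
  fix x y assume xy: "x \<in> {\<theta>\<in>\<Theta>. u j \<le> \<theta>}" "y \<in> {\<theta>\<in>\<Theta>. u j \<le> \<theta>}" "x \<le> y"
  have "measure (P y) {\<omega>\<in>space (P y). accepts_in {..<j} \<omega>}
      \<le> 1 * measure (P x) {\<omega>\<in>space (P x). accepts_in {..<j} \<omega>}"
  proof (rule acceptance_probability_le[OF _ _ _ consistent])
    fix L k assume "unimodal_likelihood \<Theta> m l u \<alpha> \<beta> L" "stops L k" "k \<in> {..<j}"
      "consistent_choice \<Theta> m \<alpha> \<beta> l u L k"
    then show "L y \<le> 1 * L x"
      using unimodal_likelihood.nonincreasing_above_rejected_pair[of \<Theta> m l u \<alpha> \<beta> L k j x y] xy j
      by simp
  qed (use xy in simp_all)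
  then show "measure (P y) {\<omega>\<in>space (P y). accepts_in {..<j} \<omega>}
      \<le> measure (P x) {\<omega>\<in>space (P x). accepts_in {..<j} \<omega>}" by simp
qed

text \<open>
  Here \<open>u j\<close> is the worst case, and it is compared with \<open>l j\<close>.
\<close>

lemma lower_acceptance_le:
  assumes j: "0 < j" "j < m" and \<theta>: "\<theta> \<in> \<Theta>" "u j \<le> \<theta>"
  shows "measure (P \<theta>) {\<omega>\<in>space (P \<theta>). accepts_in {..<j} \<omega>} \<le> \<beta> j"
proof -
  note points = points_in[OF j] thresholds[OF j]
  interpret Pl: prob_space "P (l j)" using prob points by simp
  have "measure (P \<theta>) {\<omega>\<in>space (P \<theta>). accepts_in {..<j} \<omega>}
      \<le> measure (P (u j)) {\<omega>\<in>space (P (u j)). accepts_in {..<j} \<omega>}"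
    by (rule monotone_onD[OF lower_acceptance_antimono[OF j]]) (use \<theta> points in simp_all)
  also have "\<dots> \<le> \<beta> j * measure (P (l j)) {\<omega>\<in>space (P (l j)). accepts_in {..<j} \<omega>}"
  proof (rule acceptance_probability_le[OF _ _ _ consistent])
    fix L k assume "unimodal_likelihood \<Theta> m l u \<alpha> \<beta> L" "stops L k" "k \<in> {..<j}"
      "consistent_choice \<Theta> m \<alpha> \<beta> l u L k"
    then show "L (u j) \<le> \<beta> j * L (l j)"
      using unimodal_likelihood.upper_point_bound[of \<Theta> m l u \<alpha> \<beta> L k j] j
      by simp
  qed (use points in simp_all)
  also have "\<dots> \<le> \<beta> j * 1"
    using points by (intro mult_left_mono) auto
  finally show ?thesis by simp
qed

text \<open>
  The conventions \<open>\<alpha> m = 0\<close> and \<open>\<beta> 0 = 0\<close> match the extreme hypotheses, beyond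
  which there is no index to accept.
\<close>

lemma rejection_le:
  assumes i: "i < m" and \<theta>: "\<theta> \<in> \<Theta>"
    and lower: "0 < i \<Longrightarrow> u i \<le> \<theta>" and upper: "Suc i < m \<Longrightarrow> \<theta> \<le> l (Suc i)"
    and ends: "\<alpha> m = 0" "\<beta> 0 = 0"
  shows "measure (P \<theta>) {\<omega>\<in>space (P \<theta>). rejects N m \<alpha> \<beta> l u f pol X i \<omega>} \<le> \<alpha> (Suc i) + \<beta> i"
proof -
  interpret prob_space "P \<theta>" using prob \<theta> .
  have rejects_eq: "{\<omega>\<in>space (P \<theta>). rejects N m \<alpha> \<beta> l u f pol X i \<omega>}
      = {\<omega>\<in>space (P \<theta>). accepts_in {Suc i..<m} \<omega>} \<union> {\<omega>\<in>space (P \<theta>). accepts_in {..<i} \<omega>}"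
    using i unfolding rejects_def by (auto simp: neq_iff intro: less_trans)
  have "measure (P \<theta>) {\<omega>\<in>space (P \<theta>). rejects N m \<alpha> \<beta> l u f pol X i \<omega>}
      \<le> measure (P \<theta>) {\<omega>\<in>space (P \<theta>). accepts_in {Suc i..<m} \<omega>}
      + measure (P \<theta>) {\<omega>\<in>space (P \<theta>). accepts_in {..<i} \<omega>}"
    unfolding rejects_eq
    using accepts_in_sets by (intro measure_Un_le) (simp_all add: space_P sets_P \<theta>)
  moreover have "measure (P \<theta>) {\<omega>\<in>space (P \<theta>). accepts_in {Suc i..<m} \<omega>} \<le> \<alpha> (Suc i)"
  proof (cases "Suc i < m")
    case True
    then show ?thesis by (intro upper_acceptance_le \<theta> upper) simp_all
  next
    case False
    then have "Suc i = m" using i by simp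
    then show ?thesis using ends by simp
  qed
  moreover have "measure (P \<theta>) {\<omega>\<in>space (P \<theta>). accepts_in {..<i} \<omega>} \<le> \<beta> i"
  proof (cases "i = 0")
    case True
    then show ?thesis using ends by simp
  next
    case False
    then show ?thesis by (intro lower_acceptance_le \<theta> lower i) simp_all
  qed
  ultimately show ?thesis by linarith
qed

end

text \<open>
  The event \<open>V\<close> of never stopping does not depend on \<open>n\<close>, but at each \<open>n\<close> it is
  covered by the events that some pair is undecided.
\<close>

lemma terminates_as_if_undecided_vanishes:
  assumes N: "N \<noteq> {}"
    and undecided: "\<And>\<theta> i. \<theta> \<in> \<Theta> \<Longrightarrow> 0 < i \<Longrightarrow> i < m \<Longrightarrow>
       ((\<lambda>n. measure (P \<theta>) {\<omega>\<in>space (P \<theta>).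
           LR (f n (sample X n \<omega>)) (l i) (u i) (>) (\<beta> i) \<and>
           LR (f n (sample X n \<omega>)) (l i) (u i) (<) (1 / \<alpha> i)}) \<longlongrightarrow> 0) (to_sup N)"
  shows "terminates_as P \<Theta> N m \<alpha> \<beta> l u f X"
  unfolding terminates_as_def
proof
  fix \<theta> assume \<theta>: "\<theta> \<in> \<Theta>"
  interpret prob_space "P \<theta>" using prob \<theta> .
  let ?stopped = "\<lambda>n \<omega>. \<exists>j. stops (f n (sample X n \<omega>)) j"
  let ?undecided = "\<lambda>i n. {\<omega>\<in>space (P \<theta>).
           LR (f n (sample X n \<omega>)) (l i) (u i) (>) (\<beta> i) \<and>
           LR (f n (sample X n \<omega>)) (l i) (u i) (<) (1 / \<alpha> i)}"
  have stopped_meas: "Measurable.pred (P \<theta>) (?stopped n)" if "n \<in> N" for n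
    by (rule measurable_compose[OF sample_measurable_P[OF \<theta> that] stop_index_measurable[OF that]])
  have undecided_sets: "?undecided i n \<in> events" if n: "n \<in> N" and i: "0 < i" "i < m" for n i
  proof -
    have [measurable]: "(\<lambda>\<omega>. f n (sample X n \<omega>) (l i)) \<in> borel_measurable (P \<theta>)"
        "(\<lambda>\<omega>. f n (sample X n \<omega>) (u i)) \<in> borel_measurable (P \<theta>)"
      using measurable_compose[OF sample_measurable_P[OF \<theta> n] likelihood_measurable[OF n]] points_in[OF i]
      by blast+
    show ?thesis unfolding LR_def by measurable
  qed
  define V where "V = {\<omega>\<in>space (P \<theta>). \<not> (\<exists>n\<in>N. ?stopped n \<omega>)}"
  have V_sets: "V \<in> events"
  proof -
    have "Measurable.pred (P \<theta>) (\<lambda>\<omega>. \<exists>n\<in>N. ?stopped n \<omega>)"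
      by (intro pred_intros_countable_bounded stopped_meas) auto
    then show ?thesis unfolding V_def by measurable
  qed
  have V_le: "prob V \<le> (\<Sum>i\<in>{0<..<m}. prob (?undecided i n))" if n: "n \<in> N" for n
  proof -
    have "V \<subseteq> (\<Union>i\<in>{0<..<m}. ?undecided i n)"
    proof
      fix \<omega> assume \<omega>: "\<omega> \<in> V"
      then have "\<omega> \<in> space M" unfolding V_def using space_P[OF \<theta>] by simp
      then interpret unimodal_likelihood \<Theta> m l u \<alpha> \<beta> "f n (sample X n \<omega>)"
        by (rule unimodal_likelihood_sample[OF n])
      have "\<not> ?stopped n \<omega>" using \<omega> n unfolding V_def by blast
      then obtain i where "0 < i" "i < m"
          "LR (f n (sample X n \<omega>)) (l i) (u i) (>) (\<beta> i)"
          "LR (f n (sample X n \<omega>)) (l i) (u i) (<) (1 / \<alpha> i)"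
        using stops_if_no_pair_undecided by blast
      then show "\<omega> \<in> (\<Union>i\<in>{0<..<m}. ?undecided i n)"
        using \<omega> unfolding V_def by auto
    qed
    then have "prob V \<le> prob (\<Union>i\<in>{0<..<m}. ?undecided i n)"
      using undecided_sets[OF n] by (intro finite_measure_mono) auto
    also have "\<dots> \<le> (\<Sum>i\<in>{0<..<m}. prob (?undecided i n))"
      using undecided_sets[OF n] by (intro finite_measure_subadditive_finite) auto
    finally show ?thesis .
  qed
  have lim: "((\<lambda>n. \<Sum>i\<in>{0<..<m}. prob (?undecided i n)) \<longlongrightarrow> 0) (to_sup N)"
    using undecided[OF \<theta>] by (intro tendsto_null_sum) auto
  have "to_sup N \<noteq> bot" "eventually (\<lambda>n. n \<in> N) (to_sup N)"
    using to_sup_nontrivial[OF N] by auto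
  then have "prob V \<le> 0"
    using V_le by (intro tendsto_lowerbound[OF lim]) (auto elim: eventually_mono)
  then have "prob V = 0" using measure_nonneg[of "P \<theta>" V] by linarith
  then have "AE \<omega> in P \<theta>. \<omega> \<notin> V"
    using prob_eq_0[OF V_sets] by simp
  then show "AE \<omega> in P \<theta>. \<exists>n\<in>N. ?stopped n \<omega>"
    using AE_space unfolding V_def by eventually_elim auto
qed

end

section \<open>Error probabilities and termination of the test\<close>

theorem theorem3:
  fixes M :: "'w measure" and P :: "real \<Rightarrow> 'w measure" and \<Theta> :: "real set"
    and N :: "nat set" and X :: "nat \<Rightarrow> 'w \<Rightarrow> real"
    and f :: "nat \<Rightarrow> (nat \<Rightarrow> real) \<Rightarrow> real \<Rightarrow> real"
    and m :: nat and b :: "nat \<Rightarrow> ereal" and l u \<alpha> \<beta> :: "nat \<Rightarrow> real"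
    and pol :: "nat \<Rightarrow> (nat \<Rightarrow> real) \<Rightarrow> nat"
  assumes "N \<noteq> {}" and "\<And>n. n \<in> N \<Longrightarrow> 0 < n"
    and "\<And>\<theta>. \<theta> \<in> \<Theta> \<Longrightarrow> prob_space (P \<theta>)"
    and "\<And>\<theta>. \<theta> \<in> \<Theta> \<Longrightarrow> sets (P \<theta>) = sets M"
    and "\<And>n k. n \<in> N \<Longrightarrow> k \<in> {1..n} \<Longrightarrow> X k \<in> borel_measurable M"
    and likelihood:
      "(\<forall>n\<in>N. \<forall>\<theta>\<in>\<Theta>. joint_pdf (P \<theta>) X n (\<lambda>x. f n x \<theta>)) \<or>
       (\<forall>n\<in>N. \<forall>\<theta>\<in>\<Theta>. joint_pmf (P \<theta>) X n (\<lambda>x. f n x \<theta>))"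
    and "2 \<le> m"
    and "b 0 = - \<infinity>" and "b m = \<infinity>" and "\<And>i. i < m \<Longrightarrow> b i < b (Suc i)"
    and "\<And>i. 1 \<le> i \<Longrightarrow> i \<le> m - 1 \<Longrightarrow> l i \<in> \<Theta> \<and> u i \<in> \<Theta>"
    and "\<And>i. 1 \<le> i \<Longrightarrow> i \<le> m - 1 \<Longrightarrow> ereal (l i) < b i \<and> b i < ereal (u i)"
    and "\<And>i. 1 \<le> i \<Longrightarrow> i \<le> m - 2 \<Longrightarrow> u i \<le> l (Suc i)"
    and "\<And>i. 1 \<le> i \<Longrightarrow> i \<le> m - 1 \<Longrightarrow> \<alpha> i \<in> {0<..<1} \<and> \<beta> i \<in> {0<..<1}"
    and "\<alpha> m = 0" and "\<beta> 0 = 0"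
    and policy: "stop_policy N m \<alpha> \<beta> l u f pol"
    and unimodal: "\<And>n \<omega>. n \<in> N \<Longrightarrow> \<omega> \<in> space M \<Longrightarrow> unimodal_on \<Theta> (f n (sample X n \<omega>))"
  shows
    "(terminates_as P \<Theta> N m \<alpha> \<beta> l u f X \<and> consistent_policy_as P \<Theta> N m \<alpha> \<beta> l u f pol X \<longrightarrow>
        (\<forall>i<m. \<forall>\<theta>\<in>inner_set \<Theta> m b l u i.
           measure (P \<theta>) {\<omega>\<in>space (P \<theta>). rejects N m \<alpha> \<beta> l u f pol X i \<omega>}
             \<le> \<alpha> (Suc i) + \<beta> i) \<and>
        (\<forall>j\<in>{1..m - 1}.
           (\<forall>\<theta>\<in>{\<theta>\<in>\<Theta>. \<theta> \<le> l j}.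
              measure (P \<theta>) {\<omega>\<in>space (P \<theta>).
                \<exists>i\<in>{j..<m}. accepts N m \<alpha> \<beta> l u f pol X i \<omega>} \<le> \<alpha> j) \<and>
           mono_on {\<theta>\<in>\<Theta>. \<theta> \<le> l j} (\<lambda>\<theta>.
              measure (P \<theta>) {\<omega>\<in>space (P \<theta>).
                \<exists>i\<in>{j..<m}. accepts N m \<alpha> \<beta> l u f pol X i \<omega>})) \<and>
        (\<forall>j\<in>{1..m - 1}.
           (\<forall>\<theta>\<in>{\<theta>\<in>\<Theta>. u j \<le> \<theta>}.
              measure (P \<theta>) {\<omega>\<in>space (P \<theta>).
                \<exists>i<j. accepts N m \<alpha> \<beta> l u f pol X i \<omega>} \<le> \<beta> j) \<and>
           antimono_on {\<theta>\<in>\<Theta>. u j \<le> \<theta>} (\<lambda>\<theta>.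
              measure (P \<theta>) {\<omega>\<in>space (P \<theta>).
                \<exists>i<j. accepts N m \<alpha> \<beta> l u f pol X i \<omega>}))) \<and>
     ((\<forall>a\<in>{0<..<1}. \<forall>c\<in>{0<..<1}. \<forall>\<theta>\<in>\<Theta>. \<forall>i\<in>{1..m - 1}.
         ((\<lambda>n. measure (P \<theta>) {\<omega>\<in>space (P \<theta>).
             LR (f n (sample X n \<omega>)) (l i) (u i) (>) c \<and>
             LR (f n (sample X n \<omega>)) (l i) (u i) (<) (1 / a)}) \<longlongrightarrow> 0) (to_sup N)) \<longrightarrow>
      terminates_as P \<Theta> N m \<alpha> \<beta> l u f X)"
proof -
  have pairs: "1 \<le> i \<and> i \<le> m - 1" if "0 < i" "i < m" for i
    using that by auto
  interpret csprt \<Theta> m l u \<alpha> \<beta> M P N X f pol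
  proof (intro csprt.intro test_points.intro csprt_axioms.intro)
    show "0 < m" using \<open>2 \<le> m\<close> by simp
    fix i assume i: "0 < i" "i < m"
    show "l i \<in> \<Theta> \<and> u i \<in> \<Theta>" "\<alpha> i \<in> {0<..<1} \<and> \<beta> i \<in> {0<..<1}"
      using assms(11)[of i] assms(14)[of i] pairs[OF i] by auto
    have "ereal (l i) < ereal (u i)"
      using assms(12)[of i] pairs[OF i] by (meson less_trans)
    then show "l i < u i" by simp
  next
    fix i assume "0 < i" "Suc i < m"
    then have "1 \<le> i" "i \<le> m - 2" by auto
    then show "u i \<le> l (Suc i)" by (rule assms(13))
  qed (fact assms(3) assms(4) assms(5) likelihood policy unimodal)+
  show ?thesis
  proof (intro conjI impI)
    assume "terminates_as P \<Theta> N m \<alpha> \<beta> l u f X \<and> consistent_policy_as P \<Theta> N m \<alpha> \<beta> l u f pol X"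
    then have consistent: "consistent_policy_as P \<Theta> N m \<alpha> \<beta> l u f pol X" ..
    have bex_lessThan: "(\<exists>i<j. Q i) \<longleftrightarrow> (\<exists>i\<in>{..<j}. Q i)" for j :: nat and Q
      by auto
    show "\<forall>i<m. \<forall>\<theta>\<in>inner_set \<Theta> m b l u i.
        measure (P \<theta>) {\<omega>\<in>space (P \<theta>). rejects N m \<alpha> \<beta> l u f pol X i \<omega>} \<le> \<alpha> (Suc i) + \<beta> i"
    proof (intro allI impI ballI)
      fix i \<theta> assume i: "i < m" and \<theta>: "\<theta> \<in> inner_set \<Theta> m b l u i"
      show "measure (P \<theta>) {\<omega>\<in>space (P \<theta>). rejects N m \<alpha> \<beta> l u f pol X i \<omega>} \<le> \<alpha> (Suc i) + \<beta> i"
      proof (rule rejection_le[OF consistent i _ _ _ \<open>\<alpha> m = 0\<close> \<open>\<beta> 0 = 0\<close>])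
        show "\<theta> \<in> \<Theta>" using \<theta> unfolding inner_set_def hyp_set_def by blast
        show "u i \<le> \<theta>" if "0 < i" using \<theta> that unfolding inner_set_def by simp
        show "\<theta> \<le> l (Suc i)" if "Suc i < m" using \<theta> that unfolding inner_set_def by simp
      qed
    qed
    have range: "0 < j \<and> j < m" if "j \<in> {1..m - 1}" for j
      using that by auto
    show "\<forall>j\<in>{1..m - 1}. (\<forall>\<theta>\<in>{\<theta>\<in>\<Theta>. \<theta> \<le> l j}.
           measure (P \<theta>) {\<omega>\<in>space (P \<theta>). accepts_in {j..<m} \<omega>} \<le> \<alpha> j) \<and>
         mono_on {\<theta>\<in>\<Theta>. \<theta> \<le> l j} (\<lambda>\<theta>. measure (P \<theta>) {\<omega>\<in>space (P \<theta>). accepts_in {j..<m} \<omega>})"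
      using upper_acceptance_le[OF consistent] upper_acceptance_mono[OF consistent] range by blast
    show "\<forall>j\<in>{1..m - 1}. (\<forall>\<theta>\<in>{\<theta>\<in>\<Theta>. u j \<le> \<theta>}.
           measure (P \<theta>) {\<omega>\<in>space (P \<theta>). \<exists>i<j. accepts N m \<alpha> \<beta> l u f pol X i \<omega>} \<le> \<beta> j) \<and>
         antimono_on {\<theta>\<in>\<Theta>. u j \<le> \<theta>}
           (\<lambda>\<theta>. measure (P \<theta>) {\<omega>\<in>space (P \<theta>). \<exists>i<j. accepts N m \<alpha> \<beta> l u f pol X i \<omega>})"
      unfolding bex_lessThan
      using lower_acceptance_le[OF consistent] lower_acceptance_antimono[OF consistent] range by blast
  next
    assume undecided: "\<forall>a\<in>{0<..<1}. \<forall>c\<in>{0<..<1}. \<forall>\<theta>\<in>\<Theta>. \<forall>i\<in>{1..m - 1}.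
       ((\<lambda>n. measure (P \<theta>) {\<omega>\<in>space (P \<theta>).
             LR (f n (sample X n \<omega>)) (l i) (u i) (>) c \<and>
             LR (f n (sample X n \<omega>)) (l i) (u i) (<) (1 / a)}) \<longlongrightarrow> 0) (to_sup N)"
    show "terminates_as P \<Theta> N m \<alpha> \<beta> l u f X"
    proof (rule terminates_as_if_undecided_vanishes[OF \<open>N \<noteq> {}\<close>])
      fix \<theta> i assume "\<theta> \<in> \<Theta>" "0 < i" "i < m"
      moreover from this have "i \<in> {1..m - 1}" by auto
      ultimately show "((\<lambda>n. measure (P \<theta>) {\<omega>\<in>space (P \<theta>).
             LR (f n (sample X n \<omega>)) (l i) (u i) (>) (\<beta> i) \<and>
             LR (f n (sample X n \<omega>)) (l i) (u i) (<) (1 / \<alpha> i)}) \<longlongrightarrow> 0) (to_sup N)"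
        using undecided thresholds by blast
    qed
  qed
qed

end
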